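(* Let $R$ be an isoartinian ring. Then $R/\mathfrak{p}$ is a principal ideal domain for every $\mathfrak{p}\in \operatorname{Ass} R$. Consequently $\dim R\leq 1$, and so $\operatorname{Spec} R=\operatorname{Min} R\cup \operatorname{Max} R$.
   Context: All rings are commutative with nonzero identity. A ring $R$ is isoartinian if every descending chain $I_1\supseteq I_2\supseteq\cdots$ of ideals of $R$ terminates up to isomorphism, i.e. there is $n$ such that $I_n\cong I_i$ as $R$-modules for all $i\ge n$. $\operatorname{Spec} R$, $\operatorname{Min} R$, $\operatorname{Max} R$ denote the sets of prime, minimal prime and maximal ideals of $R$; $\operatorname{Ass} R=\{\mathfrak{p}\in\operatorname{Spec} R \mid \mathfrak{p}=(0:_R x)\text{ for some }x\in R\}$, where $(0:_R x)=\{r\in R\mid rx=0\}$. $\dim$ is Krull dimension. Fields are regarded as principal ideal domains. *)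

theory Defs
  imports "HOL-Algebra.Algebra" "HOL-Library.Extended_Nat"
begin

subsection \<open>Isomorphism of modules\<close>

definition module_hom ::
    "('a, 'r) ring_scheme \<Rightarrow> ('a, 'b, 'm) module_scheme \<Rightarrow> ('a, 'c, 'n) module_scheme \<Rightarrow> ('b \<Rightarrow> 'c) set"
  where "module_hom R M N =
    {f. f \<in> carrier M \<rightarrow> carrier N \<and>
        (\<forall>x\<in>carrier M. \<forall>y\<in>carrier M. f (x \<oplus>\<^bsub>M\<^esub> y) = f x \<oplus>\<^bsub>N\<^esub> f y) \<and>
        (\<forall>r\<in>carrier R. \<forall>x\<in>carrier M. f (r \<odot>\<^bsub>M\<^esub> x) = r \<odot>\<^bsub>N\<^esub> f x)}"

definition module_isomorphic ::
    "('a, 'r) ring_scheme \<Rightarrow> ('a, 'b, 'm) module_scheme \<Rightarrow> ('a, 'c, 'n) module_scheme \<Rightarrow> bool"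
  where "module_isomorphic R M N \<longleftrightarrow>
    (\<exists>f \<in> module_hom R M N. bij_betw f (carrier M) (carrier N))"

text \<open>The ideal \<open>I\<close> as an \<open>R\<close>-module. Module records extend ring records, so the fields
  \<open>mult\<close> and \<open>one\<close> have to be filled, but they play no role in the module structure.\<close>

definition ideal_module :: "('a, 'r) ring_scheme \<Rightarrow> 'a set \<Rightarrow> ('a, 'a) module"
  where "ideal_module R I =
    \<lparr>carrier = I, monoid.mult = (\<otimes>\<^bsub>R\<^esub>), one = \<one>\<^bsub>R\<^esub>, ring.zero = \<zero>\<^bsub>R\<^esub>,
      ring.add = (\<oplus>\<^bsub>R\<^esub>), smult = (\<otimes>\<^bsub>R\<^esub>)\<rparr>"

lemma (in cring) ideal_module_is_module:
  assumes "ideal I R"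
  shows "module R (ideal_module R I)"
proof -
  interpret ideal I R by fact
  have inv: "\<exists>y\<in>I. x \<oplus> y = \<zero>" if "x \<in> I" for x
    using that a_inv_closed r_neg[OF Icarr] by blast
  show ?thesis
    by (rule moduleI; (rule is_cring)?; (rule abelian_groupI)?)
       (auto simp: ideal_module_def Icarr I_l_closed a_ac l_distr r_distr m_assoc
             intro: inv)
qed

subsection \<open>Isoartinian rings\<close>

locale isoartinian_ring = cring +
  assumes one_not_zero: "\<one> \<noteq> \<zero>"
    and descending_chain:
      "\<lbrakk>\<And>n::nat. ideal (I n) R; \<And>n. I (Suc n) \<subseteq> I n\<rbrakk> \<Longrightarrow>
        \<exists>n. \<forall>i\<ge>n. module_isomorphic R (ideal_module R (I n)) (ideal_module R (I i))"

subsection \<open>Sets of prime ideals and Krull dimension\<close>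

definition Spec :: "('a, 'r) ring_scheme \<Rightarrow> 'a set set"
  where "Spec R = {P. primeideal P R}"

definition Min_Spec :: "('a, 'r) ring_scheme \<Rightarrow> 'a set set"
  where "Min_Spec R = {P \<in> Spec R. \<forall>Q\<in>Spec R. Q \<subseteq> P \<longrightarrow> Q = P}"

definition Max_Spec :: "('a, 'r) ring_scheme \<Rightarrow> 'a set set"
  where "Max_Spec R = {P. maximalideal P R}"

definition annihilator :: "('a, 'r) ring_scheme \<Rightarrow> 'a \<Rightarrow> 'a set"
  where "annihilator R x = {r \<in> carrier R. r \<otimes>\<^bsub>R\<^esub> x = \<zero>\<^bsub>R\<^esub>}"

definition Ass :: "('a, 'r) ring_scheme \<Rightarrow> 'a set set"
  where "Ass R = {P \<in> Spec R. \<exists>x\<in>carrier R. P = annihilator R x}"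

text \<open>The supremum of the lengths \<open>n\<close> of chains \<open>P 0 \<subset> \<dots> \<subset> P n\<close> of prime ideals. Since it
  takes values in \<^typ>\<open>enat\<close>, the zero ring (which has no prime ideals) gets dimension
  \<open>0\<close>; the definition is only meaningful for nonzero rings.\<close>

definition krull_dim :: "('a, 'r) ring_scheme \<Rightarrow> enat"
  where "krull_dim R =
    (SUP n \<in> {n. \<exists>P. (\<forall>i\<le>n. P i \<in> Spec R) \<and> (\<forall>i<n. P i \<subset> P (Suc i))}. enat n)"

end

theory Submission
  imports Defs
begin

text \<open>
  If \<open>P = (0 : x)\<close> is prime, then \<open>R / P\<close> is isomorphic to \<open>R x\<close>. For an ideal \<open>K\<close> containing an
  element \<open>a \<notin> P\<close>, the chain \<open>R x \<supseteq> K x \<supseteq> a R x \<supseteq> a K x \<supseteq> a\<^sup>2 R x \<supseteq> \<dots>\<close> becomes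
  stationary up to isomorphism, so some \<open>a\<^sup>m K x\<close> is cyclic; since \<open>a\<^sup>m\<close> can be cancelled modulo \<open>P\<close>,
  the ideal \<open>K / P\<close> of \<open>R / P\<close> is principal.

  Every prime \<open>Q\<close> contains an associated prime: among the elements \<open>x\<close> with \<open>(0 : x) \<subseteq> Q\<close> there is
  one such that \<open>(0 : y) = (0 : x)\<close> for every \<open>y \<in> R x\<close> with \<open>(0 : y) \<subseteq> Q\<close>, as isomorphic cyclic
  modules have the same annihilator. Then \<open>(0 : x)\<close> is prime. Hence a prime that is not minimal
  strictly contains an associated prime \<open>P\<close>, and it is maximal because \<open>R / P\<close> is a principal ideal
  domain.
\<close>

section \<open>Isomorphisms of modules\<close>

lemma module_isomorphic_sym:
  assumes "module R M" "module_isomorphic R M N"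
  shows "module_isomorphic R N M"
proof -
  interpret M: module R M by fact
  obtain f where hom: "f \<in> module_hom R M N" and bij: "bij_betw f (carrier M) (carrier N)"
    using assms(2) by (auto simp: module_isomorphic_def)
  define g where "g = inv_into (carrier M) f"
  have g_mem: "g y \<in> carrier M" and fg: "f (g y) = y" if "y \<in> carrier N" for y
    using that bij by (auto simp: g_def bij_betw_def inv_into_into f_inv_into_f)
  have gf: "g (f x) = x" if "x \<in> carrier M" for x
    using that bij by (simp add: g_def bij_betw_def)
  have "g (y \<oplus>\<^bsub>N\<^esub> z) = g y \<oplus>\<^bsub>M\<^esub> g z" if "y \<in> carrier N" "z \<in> carrier N" for y z
  proof -
    have "f (g y \<oplus>\<^bsub>M\<^esub> g z) = y \<oplus>\<^bsub>N\<^esub> z"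
      using that hom by (simp add: module_hom_def g_mem fg)
    then show ?thesis
      using gf[of "g y \<oplus>\<^bsub>M\<^esub> g z"] that by (simp add: g_mem)
  qed
  moreover have "g (r \<odot>\<^bsub>N\<^esub> y) = r \<odot>\<^bsub>M\<^esub> g y" if "r \<in> carrier R" "y \<in> carrier N" for r y
  proof -
    have "f (r \<odot>\<^bsub>M\<^esub> g y) = r \<odot>\<^bsub>N\<^esub> y"
      using that hom by (simp add: module_hom_def g_mem fg)
    then show ?thesis
      using gf[of "r \<odot>\<^bsub>M\<^esub> g y"] that by (simp add: g_mem)
  qed
  ultimately have "g \<in> module_hom R N M"
    by (auto simp: module_hom_def g_mem)
  moreover have "bij_betw g (carrier N) (carrier M)"
    unfolding g_def using bij by (rule bij_betw_inv_into)
  ultimately show ?thesis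
    by (auto simp: module_isomorphic_def)
qed

section \<open>Ideals, annihilators and cyclic modules over a commutative ring\<close>

context cring
begin

lemma ideal_image_mult:
  assumes "ideal K R" "z \<in> carrier R"
  shows "ideal ((\<lambda>k. k \<otimes> z) ` K) R"
proof -
  interpret K: ideal K R by fact
  show ?thesis
  proof (rule idealI)
    show "subgroup ((\<lambda>k. k \<otimes> z) ` K) (add_monoid R)"
    proof
      fix u assume "u \<in> (\<lambda>k. k \<otimes> z) ` K"
      then obtain k where k: "k \<in> K" "u = k \<otimes> z" by auto
      have "inv\<^bsub>add_monoid R\<^esub> u = (\<ominus> k) \<otimes> z"
        using k assms(2) by (simp add: l_minus flip: a_inv_def)
      then show "inv\<^bsub>add_monoid R\<^esub> u \<in> (\<lambda>k. k \<otimes> z) ` K"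
        using k by auto
    next
      fix u v assume "u \<in> (\<lambda>k. k \<otimes> z) ` K" "v \<in> (\<lambda>k. k \<otimes> z) ` K"
      then show "u \<otimes>\<^bsub>add_monoid R\<^esub> v \<in> (\<lambda>k. k \<otimes> z) ` K"
        using assms(2) by (auto simp: l_distr[symmetric])
    next
      show "\<one>\<^bsub>add_monoid R\<^esub> \<in> (\<lambda>k. k \<otimes> z) ` K"
        using assms(2) by (auto intro!: image_eqI[where x = \<zero>])
    qed (use assms(2) in auto)
  next
    fix u r assume "u \<in> (\<lambda>k. k \<otimes> z) ` K" and r: "r \<in> carrier R"
    then obtain k where k: "k \<in> K" "u = k \<otimes> z" by auto
    have "r \<otimes> u = (r \<otimes> k) \<otimes> z" "u \<otimes> r = (r \<otimes> k) \<otimes> z"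
      using k r assms(2) by (simp_all add: m_ac)
    then show "r \<otimes> u \<in> (\<lambda>k. k \<otimes> z) ` K" "u \<otimes> r \<in> (\<lambda>k. k \<otimes> z) ` K"
      using k r by (auto simp: K.I_l_closed)
  qed (rule ring_axioms)
qed

lemma cgenideal_eq_image: "PIdl z = (\<lambda>r. r \<otimes> z) ` carrier R"
  by (auto simp: cgenideal_def)

lemma mem_ideal_cong_if_minus_mem:
  assumes I: "ideal I R" and c: "c \<in> carrier R" and d: "d \<in> carrier R" and cd: "c \<ominus> d \<in> I"
  shows "c \<in> I \<longleftrightarrow> d \<in> I"
proof
  interpret I: ideal I R by fact
  have "(c \<ominus> d) \<oplus> d = c"
    using c d by algebra
  then show "c \<in> I" if "d \<in> I"
    using I.a_closed[OF cd that] by simp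
  have "c \<oplus> \<ominus> (c \<ominus> d) = d"
    using c d by algebra
  then show "d \<in> I" if "c \<in> I"
    using I.a_closed[OF that I.a_inv_closed[OF cd]] by simp
qed

lemma annihilator_ideal:
  assumes "x \<in> carrier R"
  shows "ideal (annihilator R x) R"
proof (rule idealI)
  show "subgroup (annihilator R x) (add_monoid R)"
  proof
    fix u assume "u \<in> annihilator R x"
    then show "inv\<^bsub>add_monoid R\<^esub> u \<in> annihilator R x"
      using assms by (simp add: annihilator_def l_minus flip: a_inv_def)
  qed (use assms in \<open>auto simp: annihilator_def l_distr\<close>)
next
  fix a r assume "a \<in> annihilator R x" "r \<in> carrier R"
  then have "r \<otimes> a \<in> annihilator R x"
    using assms by (simp add: annihilator_def m_assoc)
  moreover have "a \<otimes> r = r \<otimes> a"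
    using \<open>a \<in> annihilator R x\<close> \<open>r \<in> carrier R\<close> by (simp add: annihilator_def m_comm)
  ultimately show "r \<otimes> a \<in> annihilator R x" "a \<otimes> r \<in> annihilator R x"
    by simp_all
qed (rule ring_axioms)

text \<open>If \<open>a\<close> kills \<open>y\<close>, it kills the image of \<open>x\<close>,
  which is a multiple of \<open>y\<close>. So the isomorphism sends \<open>a \<otimes> x\<close> to
  zero, and injectivity gives \<open>a \<otimes> x = \<zero>\<close>.\<close>

lemma annihilator_subset_if_cgenideal_isomorphic:
  assumes x: "x \<in> carrier R" and y: "y \<in> carrier R"
    and iso: "module_isomorphic R (ideal_module R (PIdl x)) (ideal_module R (PIdl y))"
  shows "annihilator R y \<subseteq> annihilator R x"
proof
  fix a assume "a \<in> annihilator R y"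
  then have a: "a \<in> carrier R" "a \<otimes> y = \<zero>"
    by (auto simp: annihilator_def)
  obtain f where hom: "f \<in> module_hom R (ideal_module R (PIdl x)) (ideal_module R (PIdl y))"
    and bij: "bij_betw f (PIdl x) (PIdl y)"
    using iso by (auto simp: module_isomorphic_def ideal_module_def)
  have smult: "f (r \<otimes> u) = r \<otimes> f u" if "r \<in> carrier R" "u \<in> PIdl x" for r u
    using hom that by (simp add: module_hom_def ideal_module_def)
  have x_mem: "x \<in> PIdl x"
    using x by (rule cgenideal_self)
  then obtain r where r: "r \<in> carrier R" "f x = r \<otimes> y"
    using bij by (auto simp: bij_betw_def cgenideal_def)
  have "a \<otimes> (r \<otimes> y) = r \<otimes> (a \<otimes> y)"
    using a(1) r(1) y by (simp add: m_lcomm)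
  then have "f (a \<otimes> x) = \<zero>"
    using smult[OF a(1) x_mem] a(2) r by simp
  moreover have "f (\<zero> \<otimes> x) = \<zero>"
    using smult[OF zero_closed x_mem] r y by simp
  moreover have "a \<otimes> x \<in> PIdl x" "\<zero> \<otimes> x \<in> PIdl x"
    using a(1) by (auto simp: cgenideal_def)
  ultimately have "a \<otimes> x = \<zero> \<otimes> x"
    using bij by (metis bij_betw_imp_inj_on inj_onD)
  then show "a \<in> annihilator R x"
    using a(1) x by (simp add: annihilator_def)
qed

text \<open>By surjectivity the image of \<open>y\<close> generates the target; written as
  \<open>k \<otimes> z\<close>, it supplies \<open>k\<close>.\<close>

lemma cyclic_if_isomorphic_cgenideal:
  assumes K: "ideal K R" and y: "y \<in> carrier R" and z: "z \<in> carrier R"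
    and iso: "module_isomorphic R (ideal_module R (PIdl y))
      (ideal_module R ((\<lambda>k. k \<otimes> z) ` K))"
  shows "\<exists>k\<in>K. \<forall>c\<in>K. \<exists>r\<in>carrier R. c \<otimes> z = r \<otimes> (k \<otimes> z)"
proof -
  obtain f
    where hom: "f \<in> module_hom R (ideal_module R (PIdl y)) (ideal_module R ((\<lambda>k. k \<otimes> z) ` K))"
    and bij: "bij_betw f (PIdl y) ((\<lambda>k. k \<otimes> z) ` K)"
    using iso by (auto simp: module_isomorphic_def ideal_module_def)
  have y_mem: "y \<in> PIdl y"
    using y by (rule cgenideal_self)
  then have "f y \<in> (\<lambda>k. k \<otimes> z) ` K"
    using bij by (auto simp: bij_betw_def)
  then obtain k where k: "k \<in> K" "f y = k \<otimes> z" by auto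
  have "\<exists>r\<in>carrier R. c \<otimes> z = r \<otimes> (k \<otimes> z)" if "c \<in> K" for c
  proof -
    have "c \<otimes> z \<in> f ` (PIdl y)"
      using that bij by (auto simp: bij_betw_def)
    then obtain r where r: "r \<in> carrier R" "c \<otimes> z = f (r \<otimes> y)"
      by (auto simp: cgenideal_def)
    then have "c \<otimes> z = r \<otimes> f y"
      using hom y_mem by (simp add: module_hom_def ideal_module_def)
    then show ?thesis
      using r k by auto
  qed
  with k show ?thesis by blast
qed

end

section \<open>Associated primes of an isoartinian ring\<close>

context isoartinian_ring
begin

text \<open>Principality modulo \<open>P\<close> is phrased by elements instead of cosets, so that
  it serves both for \<open>R Quot P\<close> and for the maximality of larger primes.\<close>

lemma ideal_principal_modulo_associated_prime:
  assumes P: "P \<in> Ass R" and K: "ideal K R"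
  shows "\<exists>k\<in>K. \<forall>c\<in>K. \<exists>r\<in>carrier R. c \<ominus> r \<otimes> k \<in> P"
proof -
  interpret K: ideal K R by fact
  obtain x where x: "x \<in> carrier R" and P_eq: "P = annihilator R x"
    using P by (auto simp: Ass_def)
  interpret P: primeideal P R
    using P by (simp add: Ass_def Spec_def)
  show ?thesis
  proof (cases "K \<subseteq> P")
    case True
    have "c \<ominus> \<zero> \<otimes> \<zero> \<in> P" if "c \<in> K" for c
      using that True K.Icarr[OF that] by (auto simp: minus_eq)
    then show ?thesis
      using K.zero_closed zero_closed by blast
  next
    case False
    \<comment> \<open>Membership in \<open>K\<close> makes the chain below descend, and
      \<open>a \<notin> P\<close> allows powers of \<open>a\<close> to be cancelled modulo
      \<open>P\<close>.\<close>
    then obtain a where a: "a \<in> K" "a \<notin> P" by auto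
    then have a_carr[simp]: "a \<in> carrier R" by simp
    define z where "z m = a [^] m \<otimes> x" for m :: nat
    \<comment> \<open>Even indices give the cyclic ideals generated by
      \<open>a [^] m \<otimes> x\<close>, odd indices the multiples of \<open>K\<close> by the same
      element.\<close>
    define I where "I n = (\<lambda>k. k \<otimes> z (n div 2)) ` (if even n then carrier R else K)" for n :: nat
    have z[simp]: "z m \<in> carrier R" for m
      using x by (simp add: z_def)
    have z_Suc: "z (Suc m) = a \<otimes> z m" for m
      using x by (simp add: z_def m_ac)
    have I_even: "I (2 * m) = PIdl (z m)" for m
      by (simp add: I_def cgenideal_eq_image)
    have I_odd: "I (Suc (2 * m)) = (\<lambda>k. k \<otimes> z m) ` K" for m
      by (simp add: I_def)
    have I_ideal: "ideal (I n) R" for n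
      unfolding I_def using K oneideal by (auto intro: ideal_image_mult)
    have I_Suc: "I (Suc n) \<subseteq> I n" for n
    proof (cases "even n")
      case True
      then obtain m where "n = 2 * m" by (rule evenE)
      then show ?thesis
        by (auto simp: I_even I_odd cgenideal_eq_image)
    next
      case False
      then obtain m where n: "n = Suc (2 * m)" by (metis oddE Suc_eq_plus1)
      have "r \<otimes> z (Suc m) \<in> (\<lambda>k. k \<otimes> z m) ` K" if "r \<in> carrier R" for r
        using that a by (auto simp: z_Suc m_assoc K.I_l_closed intro!: image_eqI[where x = "r \<otimes> a"])
      then show ?thesis
        using I_even[of "Suc m"] by (auto simp: n I_odd cgenideal_eq_image)
    qed
    obtain n where "\<forall>i\<ge>n. module_isomorphic R (ideal_module R (I n)) (ideal_module R (I i))"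
      using descending_chain[of I] I_ideal I_Suc by blast
    then have n: "module_isomorphic R (ideal_module R (I n)) (ideal_module R (I (Suc n)))"
      by simp
    \<comment> \<open>Two consecutive terms suffice, since one of them is cyclic and the other a
      multiple of \<open>K\<close>. If the odd one comes first, the isomorphism is reversed.\<close>
    have "\<exists>l m. module_isomorphic R (ideal_module R (I (2 * l))) (ideal_module R (I (Suc (2 * m))))"
    proof (cases "even n")
      case True
      then obtain m where "n = 2 * m" by (rule evenE)
      with n show ?thesis by blast
    next
      case False
      then obtain m where "n = Suc (2 * m)" by (metis oddE Suc_eq_plus1)
      moreover have "Suc (Suc (2 * m)) = 2 * Suc m" by simp
      ultimately show ?thesis
        using module_isomorphic_sym[OF ideal_module_is_module[OF I_ideal] n] by metis
    qed
    then obtain m k where k: "k \<in> K"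
      and gen: "\<And>c. c \<in> K \<Longrightarrow> \<exists>r\<in>carrier R. c \<otimes> z m = r \<otimes> (k \<otimes> z m)"
      unfolding I_even I_odd using cyclic_if_isomorphic_cgenideal[OF K z z] by metis
    have pow_notin: "a [^] m \<notin> P" for m :: nat
    proof (induction m)
      case 0
      then show ?case using P.I_notcarr P.one_imp_carrier by auto
    next
      case (Suc m)
      then show ?case using P.I_prime[of "a [^] m" a] a by auto
    qed
    have "\<exists>r\<in>carrier R. c \<ominus> r \<otimes> k \<in> P" if c: "c \<in> K" for c
    proof -
      obtain r where r: "r \<in> carrier R" "c \<otimes> z m = r \<otimes> (k \<otimes> z m)"
        using gen[OF c] by auto
      have carr[simp]: "c \<in> carrier R" "k \<in> carrier R" "r \<in> carrier R"
        using c k r by auto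
      \<comment> \<open>Since \<open>d\<close> kills \<open>z m\<close>, the product
        \<open>a [^] m \<otimes> d\<close> kills \<open>x\<close> and so lies in the prime
        \<open>P\<close>, while \<open>a [^] m\<close> does not.\<close>
      define d where "d = c \<ominus> r \<otimes> k"
      have d[simp]: "d \<in> carrier R" by (simp add: d_def)
      have "d \<otimes> z m = c \<otimes> z m \<ominus> r \<otimes> (k \<otimes> z m)"
        by (simp add: d_def minus_eq l_distr l_minus m_assoc)
      then have "d \<otimes> z m = \<zero>"
        unfolding r(2) by (simp add: minus_eq r_neg)
      then have "(a [^] m \<otimes> d) \<otimes> x = \<zero>"
        using m_lcomm[of "a [^] m" d x] x by (simp add: z_def m_assoc)
      then have "a [^] m \<otimes> d \<in> P"
        unfolding P_eq annihilator_def by simp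
      then have "d \<in> P"
        using P.I_prime[OF nat_pow_closed[OF a_carr] d] pow_notin by blast
      with r(1) show ?thesis
        unfolding d_def by (rule bexI[rotated])
    qed
    with k show ?thesis by blast
  qed
qed

text \<open>The preimage in \<open>R\<close> of an ideal of the quotient is generated modulo
  \<open>P\<close> by one element, whose coset generates the given ideal.\<close>

lemma associated_prime_quotient_principal_domain:
  assumes P: "P \<in> Ass R"
  shows "principal_domain (R Quot P)"
proof -
  interpret P: primeideal P R
    using P by (simp add: Ass_def Spec_def)
  interpret Q: domain "R Quot P"
    by (rule P.quotient_is_domain)
  interpret h: ring_hom_cring R "R Quot P" "(+>) P"
    by (rule P.rcos_ring_hom_cring)
  show ?thesis
  proof
    fix J assume J: "ideal J (R Quot P)"
    interpret J: ideal J "R Quot P" by fact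
    define K where "K = {r \<in> carrier R. P +> r \<in> J}"
    have "ideal K R"
      unfolding K_def by (rule ring_hom_ring.ideal_vimage[OF P.rcos_ring_hom_ring J])
    then obtain k where k: "k \<in> K"
      and gen: "\<And>c. c \<in> K \<Longrightarrow> \<exists>r\<in>carrier R. c \<ominus> r \<otimes> k \<in> P"
      using ideal_principal_modulo_associated_prime[OF P] by blast
    have k_carr: "k \<in> carrier R" and k_J: "P +> k \<in> J"
      using k by (auto simp: K_def)
    have "J \<subseteq> PIdl\<^bsub>R Quot P\<^esub> (P +> k)"
    proof
      fix u assume u: "u \<in> J"
      then obtain c where c: "c \<in> carrier R" "u = P +> c"
        using J.Icarr[OF u] unfolding FactRing_def A_RCOSETS_def' partial_object.simps by blast
      with u have "c \<in> K"
        unfolding K_def by blast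
      then obtain r where r: "r \<in> carrier R" "c \<ominus> r \<otimes> k \<in> P"
        using gen by blast
      then have "u = P +> (r \<otimes> k)"
        using quotient_eq_iff_same_a_r_cos[OF P.is_ideal c(1) m_closed[OF r(1) k_carr]] c(2)
        by blast
      then have "u = (P +> r) \<otimes>\<^bsub>R Quot P\<^esub> (P +> k)"
        using h.hom_mult[OF r(1) k_carr] by (rule trans)
      with h.hom_closed[OF r(1)] show "u \<in> PIdl\<^bsub>R Quot P\<^esub> (P +> k)"
        unfolding cgenideal_def by blast
    qed
    moreover have "PIdl\<^bsub>R Quot P\<^esub> (P +> k) \<subseteq> J"
      using J k_J by (rule Q.cgenideal_minimal)
    ultimately show "\<exists>b\<in>carrier (R Quot P). J = PIdl\<^bsub>R Quot P\<^esub> b"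
      using h.hom_closed[OF k_carr] by blast
  qed
qed

lemma prime_contains_associated_prime:
  assumes "Q \<in> Spec R"
  shows "\<exists>P\<in>Ass R. P \<subseteq> Q"
proof -
  interpret Q: primeideal Q R
    using assms by (simp add: Spec_def)
  \<comment> \<open>These are the elements with nonzero image in the localization at
    \<open>Q\<close>.\<close>
  define S where "S = {x \<in> carrier R. annihilator R x \<subseteq> Q}"
  have "\<exists>x\<in>S. \<forall>y\<in>S \<inter> PIdl x. annihilator R y = annihilator R x"
  proof (rule ccontr)
    assume "\<not> ?thesis"
    then have step: "\<exists>y. y \<in> S \<and> y \<in> PIdl x \<and> annihilator R y \<noteq> annihilator R x"
      if "x \<in> S" for x
      using that by blast
    have "annihilator R \<one> = {\<zero>}"
      by (auto simp: annihilator_def)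
    then have "\<one> \<in> S"
      by (simp add: S_def)
    \<comment> \<open>Dependent choice, possible because \<open>S\<close> contains
      \<open>\<one>\<close>, gives successive multiples inside \<open>S\<close> whose annihilators
      change at every step.\<close>
    then obtain x :: "nat \<Rightarrow> 'a" where x: "\<And>n. x n \<in> S"
      and x_Suc: "\<And>n. x (Suc n) \<in> PIdl (x n) \<and> annihilator R (x (Suc n)) \<noteq> annihilator R (x n)"
      using dependent_nat_choice[of "\<lambda>_ x. x \<in> S"
          "\<lambda>_ x y. y \<in> PIdl x \<and> annihilator R y \<noteq> annihilator R x"] step
      by metis
    have carr[simp]: "x n \<in> carrier R" for n
      using x by (auto simp: S_def)
    have "PIdl (x (Suc n)) \<subseteq> PIdl (x n)" for n
      using x_Suc by (intro cgenideal_minimal cgenideal_ideal) auto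
    then obtain n where "\<forall>i\<ge>n. module_isomorphic R (ideal_module R (PIdl (x n)))
        (ideal_module R (PIdl (x i)))"
      using descending_chain[of "\<lambda>n. PIdl (x n)"] cgenideal_ideal by auto
    \<comment> \<open>The isomorphism gives this inclusion. The reverse one holds because
      \<open>x (Suc n)\<close> is a multiple of \<open>x n\<close>, so the annihilators agree,
      against the choice.\<close>
    then have "annihilator R (x (Suc n)) \<subseteq> annihilator R (x n)"
      by (intro annihilator_subset_if_cgenideal_isomorphic) auto
    moreover obtain r where r: "r \<in> carrier R" "x (Suc n) = r \<otimes> x n"
      using x_Suc[of n] by (auto simp: cgenideal_def)
    have "a \<otimes> x (Suc n) = r \<otimes> (a \<otimes> x n)" if "a \<in> carrier R" for a
      unfolding r(2) using that r(1) carr by (rule m_lcomm)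
    then have "annihilator R (x n) \<subseteq> annihilator R (x (Suc n))"
      using r(1) by (auto simp: annihilator_def)
    ultimately show False
      using x_Suc[of n] by blast
  qed
  then obtain x where "x \<in> S"
    and const: "\<And>y. y \<in> S \<Longrightarrow> y \<in> PIdl x \<Longrightarrow> annihilator R y = annihilator R x"
    by blast
  have x: "x \<in> carrier R" and x_Q: "annihilator R x \<subseteq> Q"
    using \<open>x \<in> S\<close> by (auto simp: S_def)
  \<comment> \<open>Multiplication by \<open>s \<notin> Q\<close> does not leave \<open>S\<close>:
    if \<open>r \<otimes> s\<close> kills \<open>x\<close>, it lies in \<open>Q\<close>, hence so
    does \<open>r\<close>.\<close>
  have annihilator_mult: "annihilator R (s \<otimes> x) = annihilator R x" if s: "s \<in> carrier R" "s \<notin> Q" for s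
  proof (rule const)
    have "r \<in> Q" if "r \<in> annihilator R (s \<otimes> x)" for r
    proof -
      have r: "r \<in> carrier R"
        using that by (simp add: annihilator_def)
      have "r \<otimes> s \<in> annihilator R x"
        using that s x by (simp add: annihilator_def m_assoc)
      then show ?thesis
        using x_Q Q.I_prime[of r s] r s by auto
    qed
    then show "s \<otimes> x \<in> S"
      using s x by (auto simp: S_def)
  qed (use s in \<open>auto simp: cgenideal_def\<close>)
  have "primeideal (annihilator R x) R"
  proof (rule primeidealI)
    show "carrier R \<noteq> annihilator R x"
      using x_Q Q.I_notcarr Q.a_subset by blast
  next
    fix a b assume a: "a \<in> carrier R" and b: "b \<in> carrier R" and ab: "a \<otimes> b \<in> annihilator R x"
    have b_ann: "b \<in> annihilator R (a \<otimes> x)"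
      using a b ab x by (simp add: annihilator_def m_ac)
    show "a \<in> annihilator R x \<or> b \<in> annihilator R x"
    \<comment> \<open>Either \<open>a \<otimes> x\<close> is in \<open>S\<close> and
      \<open>b\<close> kills \<open>x\<close>, or some \<open>s \<notin> Q\<close> kills
      \<open>a \<otimes> x\<close>; then \<open>a\<close> kills \<open>s \<otimes> x\<close> and
      therefore \<open>x\<close>.\<close>
    proof (cases "annihilator R (a \<otimes> x) \<subseteq> Q")
      case True
      then have "annihilator R (a \<otimes> x) = annihilator R x"
        using a x by (intro const) (auto simp: S_def cgenideal_def)
      then show ?thesis
        using b_ann by simp
    next
      case False
      then obtain s where s: "s \<in> carrier R" "s \<notin> Q" "s \<otimes> (a \<otimes> x) = \<zero>"
        by (auto simp: annihilator_def)
      then have "a \<in> annihilator R (s \<otimes> x)"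
        using a x by (simp add: annihilator_def m_lcomm)
      then show ?thesis
        using annihilator_mult[OF s(1,2)] by simp
    qed
  qed (use x annihilator_ideal is_cring in auto)
  then have "annihilator R x \<in> Ass R"
    using x by (auto simp: Ass_def Spec_def)
  with x_Q show ?thesis by blast
qed

text \<open>This is the proof that nonzero primes of a principal ideal domain are maximal, carried
  out modulo \<open>P\<close>. For an ideal \<open>M\<close> above \<open>Q\<close>, a generator
  \<open>k\<close> of \<open>Q\<close> is a multiple \<open>r \<otimes> m\<close> of a generator of
  \<open>M\<close>, and primality of \<open>Q\<close> forces \<open>m \<in> Q\<close> or
  \<open>r \<in> Q\<close>.\<close>

lemma maximalideal_if_contains_associated_prime:
  assumes P: "P \<in> Ass R" and Q: "Q \<in> Spec R" and "P \<subset> Q"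
  shows "maximalideal Q R"
proof -
  interpret P: primeideal P R
    using P by (simp add: Ass_def Spec_def)
  interpret Q: primeideal Q R
    using Q by (simp add: Spec_def)
  show ?thesis
  proof (rule maximalidealI)
    fix M assume M: "ideal M R" and "Q \<subseteq> M"
    interpret M: ideal M R by fact
    obtain k where k: "k \<in> Q" and k_gen: "\<And>c. c \<in> Q \<Longrightarrow> \<exists>r\<in>carrier R. c \<ominus> r \<otimes> k \<in> P"
      using ideal_principal_modulo_associated_prime[OF P Q.is_ideal] by blast
    obtain m where m: "m \<in> M" and m_gen: "\<And>c. c \<in> M \<Longrightarrow> \<exists>r\<in>carrier R. c \<ominus> r \<otimes> m \<in> P"
      using ideal_principal_modulo_associated_prime[OF P M] by blast
    have carr: "k \<in> carrier R" "m \<in> carrier R"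
      using k m by auto
    have mem_if_gen_mem: "J \<subseteq> I"
      if I: "ideal I R" "P \<subseteq> I" "l \<in> I" and "J \<subseteq> carrier R"
        and gen: "\<And>c. c \<in> J \<Longrightarrow> \<exists>r\<in>carrier R. c \<ominus> r \<otimes> l \<in> P" for I J l
    proof
      fix c assume "c \<in> J"
      then obtain r where r: "r \<in> carrier R" "c \<ominus> r \<otimes> l \<in> I"
        using gen I(2) by blast
      have "r \<otimes> l \<in> I"
        using I(1,3) r(1) by (rule ideal.I_l_closed)
      then show "c \<in> I"
        using mem_ideal_cong_if_minus_mem[OF I(1) _ ideal.Icarr[OF I(1)] r(2)] \<open>c \<in> J\<close> \<open>J \<subseteq> carrier R\<close>
        by blast
    qed
    \<comment> \<open>Otherwise all of \<open>Q\<close> would lie in \<open>P\<close>.\<close>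
    have k_notin: "k \<notin> P"
      using mem_if_gen_mem[OF P.is_ideal _ _ Q.a_subset k_gen] \<open>P \<subset> Q\<close> by blast
    obtain r where r: "r \<in> carrier R" "k \<ominus> r \<otimes> m \<in> P"
      using m_gen k \<open>Q \<subseteq> M\<close> by blast
    have rm: "r \<otimes> m \<in> Q"
      using mem_ideal_cong_if_minus_mem[OF Q.is_ideal carr(1) m_closed[OF r(1) carr(2)]]
        r(2) k \<open>P \<subset> Q\<close> by blast
    show "M = Q \<or> M = carrier R"
    proof (cases "m \<in> Q")
      case True
      then show ?thesis
        using mem_if_gen_mem[OF Q.is_ideal _ _ M.a_subset m_gen] \<open>P \<subset> Q\<close> \<open>Q \<subseteq> M\<close> by blast
    next
      case False
      then have "r \<in> Q"
        using Q.I_prime[OF r(1) carr(2) rm] by blast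
      then obtain s where s: "s \<in> carrier R" "r \<ominus> s \<otimes> k \<in> P"
        using k_gen by blast
      have sm: "s \<otimes> m \<in> carrier R" "\<one> \<ominus> s \<otimes> m \<in> carrier R"
        by (intro minus_closed one_closed m_closed s(1) carr(2))+
      \<comment> \<open>Modulo \<open>P\<close>, \<open>r\<close> is \<open>s \<otimes> k\<close>
        and \<open>k\<close> is \<open>r \<otimes> m\<close>. Both summands on the left lie in
        \<open>P\<close>, and cancelling \<open>k\<close> leaves
        \<open>\<one> \<ominus> s \<otimes> m\<close> in \<open>P\<close>, hence in
        \<open>M\<close>.\<close>
      have "(k \<ominus> r \<otimes> m) \<oplus> m \<otimes> (r \<ominus> s \<otimes> k) = k \<otimes> (\<one> \<ominus> s \<otimes> m)"
        using carr r(1) s(1) by algebra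
      with P.a_closed[OF r(2) P.I_l_closed[OF s(2) carr(2)]]
      have "k \<otimes> (\<one> \<ominus> s \<otimes> m) \<in> P"
        by (rule back_subst)
      then have "\<one> \<ominus> s \<otimes> m \<in> M"
        using P.I_prime[OF carr(1) sm(2)] k_notin \<open>P \<subset> Q\<close> \<open>Q \<subseteq> M\<close> by blast
      then have "\<one> \<in> M"
        using mem_ideal_cong_if_minus_mem[OF M one_closed sm(1)] M.I_l_closed[OF m s(1)] by blast
      then show ?thesis
        using M.one_imp_carrier by blast
    qed
  qed (rule Q.is_ideal Q.I_notcarr)+
qed

section \<open>Krull dimension and the spectrum\<close>

lemma maximalideal_if_prime_psubset:
  assumes "Q \<in> Spec R" "Q' \<in> Spec R" "Q' \<subset> Q"
  shows "maximalideal Q R"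
proof -
  obtain P where "P \<in> Ass R" "P \<subseteq> Q'"
    using prime_contains_associated_prime[OF assms(2)] by blast
  then show ?thesis
    using maximalideal_if_contains_associated_prime[of P Q] assms by blast
qed

text \<open>In a chain of three primes the middle one would be maximal, as it strictly contains a
  prime, yet it lies strictly inside a proper ideal.\<close>

lemma krull_dim_le_1: "krull_dim R \<le> 1"
  unfolding krull_dim_def
proof (rule SUP_least)
  fix n :: nat
  assume "n \<in> {n. \<exists>P. (\<forall>i\<le>n. P i \<in> Spec R) \<and> (\<forall>i<n. P i \<subset> P (Suc i))}"
  then obtain P where Spec: "\<And>i. i \<le> n \<Longrightarrow> P i \<in> Spec R"
    and chain: "\<And>i. i < n \<Longrightarrow> P i \<subset> P (Suc i)"
    by auto
  have "n \<le> 1"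
  proof (rule ccontr)
    assume "\<not> n \<le> 1"
    then interpret max: maximalideal "P (Suc 0)" R
      using maximalideal_if_prime_psubset[of "P (Suc 0)" "P 0"] Spec chain by simp
    interpret prime: primeideal "P (Suc (Suc 0))" R
      using Spec \<open>\<not> n \<le> 1\<close> by (simp add: Spec_def)
    have "P (Suc 0) \<subset> P (Suc (Suc 0))"
      using chain \<open>\<not> n \<le> 1\<close> by simp
    then show False
      using max.I_maximal[OF prime.is_ideal] prime.I_notcarr prime.a_subset by blast
  qed
  then show "enat n \<le> 1"
    by (simp add: one_enat_def)
qed

lemma Spec_eq_Min_Spec_Un_Max_Spec: "Spec R = Min_Spec R \<union> Max_Spec R"
proof
  show "Spec R \<subseteq> Min_Spec R \<union> Max_Spec R"
    using maximalideal_if_prime_psubset by (auto simp: Min_Spec_def Max_Spec_def)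
  show "Min_Spec R \<union> Max_Spec R \<subseteq> Spec R"
    using maximalideal_prime by (auto simp: Min_Spec_def Max_Spec_def Spec_def)
qed

end

theorem proposition2p3:
  fixes R :: "('a, 'r) ring_scheme"
  assumes "isoartinian_ring R"
  shows "(\<forall>P \<in> Ass R. principal_domain (R Quot P)) \<and>
    krull_dim R \<le> 1 \<and>
    Spec R = Min_Spec R \<union> Max_Spec R"
proof -
  interpret isoartinian_ring R by fact
  show ?thesis
    using associated_prime_quotient_principal_domain krull_dim_le_1 Spec_eq_Min_Spec_Un_Max_Spec
    by blast
qed

end
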